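(* Let $p\in[1,\infty]$, let $n\ge 1$, and let $f(z)=\sum_{\alpha}a_\alpha z^\alpha+\sum_\alpha\overline{b}_\alpha\overline{z}^\alpha$ be a pluriharmonic function of $\mathbb{B}_{\ell_p^n}$ into $\mathbb{D}$. Then for all multi-indices $\alpha$ with $|\alpha|\geq 1$, $$|a_\alpha|+|b_\alpha|\leq\frac{4}{\pi}\left(\frac{|\alpha|^{|\alpha|}}{\alpha^\alpha}\right)^{\frac1p}.$$ Moreover, the constant $4/\pi$ is sharp (it cannot be replaced by a smaller constant).
   Context: For $p\in[1,\infty)$, $\|z\|_p=(\sum_j|z_j|^p)^{1/p}$, and $\|z\|_\infty=\max_j|z_j|$; $\mathbb{B}_{\ell_p^n}=\{z\in\mathbb{C}^n:\|z\|_p<1\}$; $\mathbb{D}$ is the open unit disc in $\mathbb{C}$. Multi-indices $\alpha=(\alpha_1,\dots,\alpha_n)$ consist of nonnegative integers; $|\alpha|=\sum_k\alpha_k$, $z^\alpha=\prod_k z_k^{\alpha_k}$, $\alpha^\alpha=\prod_k\alpha_k^{\alpha_k}$ with $0^0=1$; $1/p=0$ when $p=\infty$. A twice continuously differentiable complex-valued function $f$ on a domain $\Omega\subset\mathbb{C}^n$ is pluriharmonic if for each fixed $z\in\Omega$ and $\theta\in\mathbb{C}^n$ with $\|\theta\|_2=1$, the function $\zeta\mapsto f(z+\zeta\theta)$ is harmonic in $\{|\zeta|<d_\Omega(z)\}$, where $d_\Omega(z)$ is the Euclidean distance from $z$ to $\partial\Omega$. On $\mathbb{B}_{\ell_p^n}$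 such an $f$ has the form $f=h+\overline g$ with $h,g$ holomorphic, and the displayed expansion means $h=\sum_\alpha a_\alpha z^\alpha$, $g=\sum_\alpha b_\alpha z^\alpha$. *)

theory Defs
  imports "HOL-Analysis.Analysis"
begin

(* Summands are powr'ed norms, so a zero coordinate contributes 0 powr p = 0. *)
definition lp_norm :: "ereal \<Rightarrow> complex ^ 'n \<Rightarrow> real" where
  "lp_norm p z =
     (if p = \<infinity> then Max (range (\<lambda>j. cmod (z $ j)))
      else (\<Sum>j\<in>UNIV. cmod (z $ j) powr real_of_ereal p) powr (1 / real_of_ereal p))"

definition lp_ball :: "ereal \<Rightarrow> (complex ^ 'n) set" where
  "lp_ball p = {z. lp_norm p z < 1}"

(* All derivatives here are real Frechet derivatives, also between complex spaces.
   For open S they are unique on S. *)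
definition has_C2_derivs_on ::
  "('a::real_normed_vector \<Rightarrow> 'b::real_normed_vector) \<Rightarrow> ('a \<Rightarrow> 'a \<Rightarrow>\<^sub>L 'b)
     \<Rightarrow> ('a \<Rightarrow> 'a \<Rightarrow>\<^sub>L 'a \<Rightarrow>\<^sub>L 'b) \<Rightarrow> 'a set \<Rightarrow> bool" where
  "has_C2_derivs_on f f' f'' S \<longleftrightarrow>
     (\<forall>x\<in>S. (f has_derivative blinfun_apply (f' x)) (at x)) \<and>
     (\<forall>x\<in>S. (f' has_derivative blinfun_apply (f'' x)) (at x)) \<and>
     continuous_on S f''"

definition C2_on :: "('a::real_normed_vector \<Rightarrow> 'b::real_normed_vector) \<Rightarrow> 'a set \<Rightarrow> bool" where
  "C2_on f S \<longleftrightarrow> (\<exists>f' f''. has_C2_derivs_on f f' f'' S)"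

(* With zeta = x + i y, the second derivative evaluated at (1,1) is d^2/dx^2 and at (i,i)
   is d^2/dy^2, so the last conjunct says that the Laplacian vanishes. *)
definition harmonic_on :: "(complex \<Rightarrow> complex) \<Rightarrow> complex set \<Rightarrow> bool" where
  "harmonic_on u S \<longleftrightarrow>
     (\<exists>u' u''. has_C2_derivs_on u u' u'' S \<and>
        (\<forall>\<zeta>\<in>S. blinfun_apply (blinfun_apply (u'' \<zeta>) 1) 1
               + blinfun_apply (blinfun_apply (u'' \<zeta>) \<i>) \<i> = 0))"

(* Extended-real valued, so that the distance to an empty boundary is infinite
   (infdist would give 0). *)
definition boundary_dist :: "'a::metric_space set \<Rightarrow> 'a \<Rightarrow> ereal" where
  "boundary_dist \<Omega> z = (INF w\<in>frontier \<Omega>. ereal (dist z w))"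

(* The norm of the type complex ^ 'n is the Euclidean norm. *)
definition pluriharmonic_on :: "(complex ^ 'n \<Rightarrow> complex) \<Rightarrow> (complex ^ 'n) set \<Rightarrow> bool" where
  "pluriharmonic_on f \<Omega> \<longleftrightarrow>
     open \<Omega> \<and> connected \<Omega> \<and> C2_on f \<Omega> \<and>
     (\<forall>z\<in>\<Omega>. \<forall>\<theta>. norm \<theta> = 1 \<longrightarrow>
        harmonic_on (\<lambda>\<zeta>. f (z + \<zeta> *s \<theta>)) {\<zeta>. ereal (cmod \<zeta>) < boundary_dist \<Omega> z})"

definition mi_abs :: "('n::finite \<Rightarrow> nat) \<Rightarrow> nat" where
  "mi_abs \<alpha> = (\<Sum>k\<in>UNIV. \<alpha> k)"

definition mi_monom :: "complex ^ 'n \<Rightarrow> ('n \<Rightarrow> nat) \<Rightarrow> complex" where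
  "mi_monom z \<alpha> = (\<Prod>k\<in>UNIV. (z $ k) ^ \<alpha> k)"

definition mi_self_power :: "('n::finite \<Rightarrow> nat) \<Rightarrow> nat" where
  "mi_self_power \<alpha> = (\<Prod>k\<in>UNIV. \<alpha> k ^ \<alpha> k)"

(* f = h + cnj g on S with h(z) = sum a_alpha z^alpha and g(z) = sum b_alpha z^alpha.
   Each series is summed separately and unconditionally over all multi-indices; for a
   holomorphic function on a complete Reinhardt domain such as lp_ball p the monomial
   expansion converges in this sense at every point. *)
definition has_pluriharmonic_expansion_on ::
  "(complex ^ 'n \<Rightarrow> complex) \<Rightarrow> (('n \<Rightarrow> nat) \<Rightarrow> complex) \<Rightarrow> (('n \<Rightarrow> nat) \<Rightarrow> complex)
     \<Rightarrow> (complex ^ 'n) set \<Rightarrow> bool" where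
  "has_pluriharmonic_expansion_on f a b S \<longleftrightarrow>
     (\<exists>h g. \<forall>z\<in>S.
        ((\<lambda>\<alpha>. a \<alpha> * mi_monom z \<alpha>) has_sum h z) UNIV \<and>
        ((\<lambda>\<alpha>. b \<alpha> * mi_monom z \<alpha>) has_sum g z) UNIV \<and>
        f z = h z + cnj (g z))"

end

theory Submission
  imports Defs "HOL-Computational_Algebra.Polynomial"
begin

text \<open>
The coefficient estimate rests on one scalar fact, lemma \<open>trig_sum_coeff_bound\<close>: if a
trigonometric sum is bounded by \<open>R\<close> in modulus, then its coefficients \<open>A\<close> and \<open>B\<close> at the
frequencies \<open>m\<close> and \<open>-m\<close> satisfy \<open>|A| + |B| \<le> 4 R / \<pi>\<close>. Indeed, after a translation that
aligns the phases, \<open>|A| + |B|\<close> is the modulus of the mean of the sum against a kernel of modulus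
\<open>2 |sin(m s)|\<close>, and the mean of \<open>2 |sin(m s)|\<close> over a period is \<open>4/\<pi>\<close>.

To reach a single multi-index \<open>\<alpha>\<close>, restrict \<open>f\<close> to the closed curve
\<open>s \<mapsto> (r_k exp(i M_k s))_k\<close> inside the torus \<open>|z_k| = r_k\<close>. There the monomial \<open>z^\<beta>\<close>
oscillates with frequency \<open>\<Sum> M_k \<beta>_k\<close>, so both series become absolutely convergent
trigonometric series. Up to an error \<open>\<epsilon>\<close>, uniform in \<open>s\<close> and independent of \<open>M\<close>, only finitely
many multi-indices matter, and for finitely many of them \<open>M\<close> can be chosen so that no other one has the
frequency of \<open>\<alpha>\<close> (\<open>separating_weights\<close>). With \<open>\<epsilon> \<rightarrow> 0\<close> this gives
\<open>(|a_\<alpha>| + |b_\<alpha>|) r^\<alpha> \<le> 4/\<pi>\<close> for each torus in the domain (\<open>torus_coeff_bound\<close>), without any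
integration over the torus itself. The radii that maximise \<open>r^\<alpha>\<close> over the closed \<open>p\<close>-ball are
\<open>r_k = (\<alpha>_k / |\<alpha>|)^(1/p)\<close>; they lie on its boundary and are approached from inside.

The constant is attained by \<open>f(z) = (4/\<pi>) Re (Arctan z_k)\<close>: the inverse tangent maps the unit disc
into the strip \<open>|Re w| < \<pi>/4\<close> and has derivative 1 at the origin, so for the \<open>k\<close>-th unit
multi-index \<open>|a_\<alpha>| = |b_\<alpha>| = 2/\<pi>\<close>, while \<open>|\<alpha>|^|\<alpha>| / \<alpha>^\<alpha> = 1\<close>.
\<close>

section \<open>A Fourier coefficient bound for trigonometric sums\<close>

text \<open>
The integrand is a chain of \<open>2 m\<close> equal arches of length \<open>\<pi>/m\<close>, each of area \<open>2/m\<close>.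
\<close>
lemma has_integral_abs_sin_multiple:
  fixes m :: nat
  assumes "m > 0"
  shows "((\<lambda>s. \<bar>sin (real m * s)\<bar>) has_integral 4) {0..2 * pi}"
proof -
  have piece: "((\<lambda>s. \<bar>sin (real m * s)\<bar>) has_integral 2 / m) {real j * pi / m..real (Suc j) * pi / m}" for j
  proof -
    have "((\<lambda>s. (-1)^j * sin (real m * s)) has_integral
        (- ((-1)^j * cos (real m * (real (Suc j) * pi / m)) / m) - (- ((-1)^j * cos (real m * (real j * pi / m)) / m))))
        {real j * pi / m..real (Suc j) * pi / m}"
      by (rule fundamental_theorem_of_calculus)
         (use assms in \<open>auto intro!: derivative_eq_intros divide_right_mono
            simp: has_real_derivative_iff_has_vector_derivative[symmetric]\<close>)
    moreover have "real m * (real (Suc j) * pi / m) = real (Suc j) * pi" "real m * (real j * pi / m) = real j * pi"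
      using assms by simp_all
    moreover have "(-1)^j * cos (real (Suc j) * pi) = (-1::real)" "(-1)^j * cos (real j * pi) = (1::real)"
      using cos_npi[of "Suc j"] cos_npi[of j] by (simp_all del: of_nat_Suc flip: power_mult_distrib)
    ultimately have *: "((\<lambda>s. (-1)^j * sin (real m * s)) has_integral 2 / m) {real j * pi / m..real (Suc j) * pi / m}"
      by (simp del: of_nat_Suc)
    show ?thesis
    proof (rule has_integral_eq[OF _ *])
      fix s assume s: "s \<in> {real j * pi / m..real (Suc j) * pi / m}"
      define y where "y = real m * s - real j * pi"
      have "0 \<le> y" "y \<le> pi"
        using s assms by (auto simp: y_def field_simps)
      then have "0 \<le> sin y" by (rule sin_ge_zero)
      moreover have "sin (real m * s) = (-1)^j * sin y"
        unfolding y_def by (simp add: sin_diff flip: mult.assoc power_mult_distrib)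
      ultimately show "(-1)^j * sin (real m * s) = \<bar>sin (real m * s)\<bar>"
        by (simp add: abs_mult flip: mult.assoc power_mult_distrib)
    qed
  qed
  have "((\<lambda>s. \<bar>sin (real m * s)\<bar>) has_integral real j * (2 / m)) {0..real j * pi / m}" for j
  proof (induction j)
    case (Suc j)
    have "((\<lambda>s. \<bar>sin (real m * s)\<bar>) has_integral real j * (2 / m) + 2 / m) {0..real (Suc j) * pi / m}"
      by (rule has_integral_combine[OF _ _ Suc piece]) (use assms in \<open>auto simp: field_simps\<close>)
    then show ?case by (simp add: algebra_simps add_divide_distrib)
  qed (auto simp: has_integral_refl)
  from this[of "2 * m"] assms show ?thesis by simp
qed

lemma has_integral_cis_int:
  fixes k :: int
  shows "((\<lambda>s. cis (of_int k * s)) has_integral (if k = 0 then complex_of_real (2 * pi) else 0)) {0..2 * pi}"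
proof (cases "k = 0")
  case True
  then show ?thesis using has_integral_const_real[of "1::complex" 0 "2 * pi"] by (simp add: scaleR_conv_of_real)
next
  case False
  have "((\<lambda>s. cis (of_int k * s)) has_integral
      (cis (of_int k * (2 * pi)) / (\<i> * of_int k) - cis (of_int k * 0) / (\<i> * of_int k))) {0..2 * pi}"
  proof (rule fundamental_theorem_of_calculus)
    fix s
    have "((\<lambda>w. exp (\<i> * (of_int k * w)) / (\<i> * of_int k)) has_field_derivative exp (\<i> * (of_int k * of_real s))) (at (of_real s))"
      using False by (auto intro!: derivative_eq_intros simp: mult_ac)
    from has_vector_derivative_real_field[OF this]
    show "((\<lambda>s. cis (of_int k * s) / (\<i> * of_int k)) has_vector_derivative cis (of_int k * s)) (at s within {0..2 * pi})"
      by (simp add: cis_conv_exp)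
  qed auto
  moreover have "cis (of_int k * (2 * pi)) = 1"
    using cis_multiple_2pi[of "of_int k"] by (simp add: mult.commute mult.left_commute)
  ultimately show ?thesis using False by simp
qed

text \<open>
For any coefficients, integrating against \<open>exp(-i m s) - exp(i m s)\<close>, whose modulus is
\<open>2 |sin(m s)|\<close>, isolates \<open>A x - B x\<close> and bounds it by \<open>4 R / \<pi>\<close>. A translation of \<open>s\<close> preserves the
bound \<open>R\<close> but rotates the two coefficients in opposite directions, so the difference can be replaced
by the sum of the moduli. Only \<open>x\<close> needs a frequency of its own; the other indices may share theirs.
\<close>
lemma trig_sum_coeff_bound:
  fixes A B :: "'b \<Rightarrow> complex" and N :: "'b \<Rightarrow> nat"
  assumes "finite K" "x \<in> K" "N x > 0" and unique: "\<And>y. y \<in> K \<Longrightarrow> y \<noteq> x \<Longrightarrow> N y \<noteq> N x"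
    and bound: "\<And>s. cmod (\<Sum>y\<in>K. A y * cis (real (N y) * s) + B y * cis (- (real (N y) * s))) \<le> R"
  shows "cmod (A x) + cmod (B x) \<le> 4 / pi * R"
proof -
  define m where "m = N x"
  have "m > 0" using assms m_def by simp
  define P where "P A B s = (\<Sum>y\<in>K. A y * cis (real (N y) * s) + B y * cis (- (real (N y) * s)))"
    for A B :: "'b \<Rightarrow> complex" and s
  have diff: "cmod (A x - B x) \<le> 4 / pi * R" if P: "\<And>s. cmod (P A B s) \<le> R" for A B
  proof -
    let ?I = "\<lambda>k::int. if k = 0 then complex_of_real (2 * pi) else 0"
    have "((\<lambda>s. \<Sum>y\<in>K. A y * cis (of_int (int (N y) - int m) * s) - A y * cis (of_int (int (N y) + int m) * s)
             + B y * cis (of_int (- int (N y) - int m) * s) - B y * cis (of_int (int m - int (N y)) * s)) has_integral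
       (\<Sum>y\<in>K. A y * ?I (int (N y) - int m) - A y * ?I (int (N y) + int m)
             + B y * ?I (- int (N y) - int m) - B y * ?I (int m - int (N y)))) {0..2 * pi}"
      by (intro has_integral_sum has_integral_add has_integral_diff has_integral_mult_right
            has_integral_cis_int \<open>finite K\<close>)
    also have "(\<lambda>s. \<Sum>y\<in>K. A y * cis (of_int (int (N y) - int m) * s) - A y * cis (of_int (int (N y) + int m) * s)
             + B y * cis (of_int (- int (N y) - int m) * s) - B y * cis (of_int (int m - int (N y)) * s))
        = (\<lambda>s. P A B s * (- 2 * \<i> * sin (real m * s)))"
    proof
      fix s
      have kernel: "- 2 * \<i> * sin (real m * s) = cis (- (real m * s)) - cis (real m * s)"
        by (simp add: complex_eq_iff)
      show "(\<Sum>y\<in>K. A y * cis (of_int (int (N y) - int m) * s) - A y * cis (of_int (int (N y) + int m) * s)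
             + B y * cis (of_int (- int (N y) - int m) * s) - B y * cis (of_int (int m - int (N y)) * s))
        = P A B s * (- 2 * \<i> * sin (real m * s))"
        unfolding P_def kernel sum_distrib_right
        by (intro sum.cong refl) (simp add: algebra_simps cis_mult minus_diff_commute)
    qed
    also have "(\<Sum>y\<in>K. A y * ?I (int (N y) - int m) - A y * ?I (int (N y) + int m)
             + B y * ?I (- int (N y) - int m) - B y * ?I (int m - int (N y)))
        = (\<Sum>y\<in>K. if y = x then (A x - B x) * (2 * pi) else 0)"
    proof (intro sum.cong refl)
      fix y assume "y \<in> K"
      then have "N y = m \<longleftrightarrow> y = x" using unique by (auto simp: m_def)
      then show "A y * ?I (int (N y) - int m) - A y * ?I (int (N y) + int m)
             + B y * ?I (- int (N y) - int m) - B y * ?I (int m - int (N y))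
          = (if y = x then (A x - B x) * (2 * pi) else 0)"
        using \<open>m > 0\<close> by (auto simp: algebra_simps)
    qed
    also have "\<dots> = (A x - B x) * (2 * pi)"
      using assms by simp
    finally have int: "((\<lambda>s. P A B s * (- 2 * \<i> * sin (real m * s))) has_integral (A x - B x) * (2 * pi)) {0..2 * pi}" .
    have "norm (integral {0..2 * pi} (\<lambda>s. P A B s * (- 2 * \<i> * sin (real m * s)))) \<le>
        integral {0..2 * pi} (\<lambda>s. (2 * R) * \<bar>sin (real m * s)\<bar>)"
    proof (rule integral_norm_bound_integral)
      show "(\<lambda>s. 2 * R * \<bar>sin (real m * s)\<bar>) integrable_on {0..2 * pi}"
        using has_integral_mult_right[OF has_integral_abs_sin_multiple[OF \<open>m > 0\<close>]] by blast
      show "norm (P A B s * (- 2 * \<i> * sin (real m * s))) \<le> 2 * R * \<bar>sin (real m * s)\<bar>" for s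
        using mult_right_mono[OF P[of s], of "\<bar>sin (real m * s)\<bar>"] by (simp add: norm_mult)
    qed (use int in blast)
    also have "\<dots> = 2 * R * 4"
      using has_integral_mult_right[OF has_integral_abs_sin_multiple[OF \<open>m > 0\<close>]] by blast
    finally have "cmod (A x - B x) * (2 * pi) \<le> 2 * R * 4"
      unfolding integral_unique[OF int] by (simp only: norm_mult norm_of_real) simp
    then show ?thesis by (simp add: field_simps)
  qed
  \<comment> \<open>the rotation for which \<open>A x\<close> and \<open>- B x\<close>, turned by \<open>\<phi>\<close> and \<open>- \<phi>\<close>, get the same argument\<close>
  define \<phi> where "\<phi> = (Arg (B x) - Arg (A x) + pi) / 2"
  define t where "t = \<phi> / m"
  have P_shift: "P (\<lambda>y. A y * cis (real (N y) * t)) (\<lambda>y. B y * cis (- (real (N y) * t))) s = P A B (s + t)" for s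
    unfolding P_def by (intro sum.cong refl) (simp add: cis_mult algebra_simps)
  have "cmod (A x * cis (real (N x) * t) - B x * cis (- (real (N x) * t))) \<le> 4 / pi * R"
    by (rule diff) (use bound in \<open>simp add: P_shift, simp add: P_def\<close>)
  moreover have "real (N x) * t = \<phi>" using \<open>m > 0\<close> by (simp add: t_def m_def)
  moreover have "A x * cis \<phi> - B x * cis (- \<phi>) = (cmod (A x) + cmod (B x)) * cis (Arg (A x) + \<phi>)"
  proof -
    have "A x * cis \<phi> = cmod (A x) * cis (Arg (A x) + \<phi>)"
      by (subst rcis_cmod_Arg[of "A x", symmetric]) (simp add: rcis_def cis_mult mult.assoc)
    moreover have "B x * cis (- \<phi>) = cmod (B x) * cis (Arg (B x) - \<phi>)"
      by (subst rcis_cmod_Arg[of "B x", symmetric]) (simp add: rcis_def cis_mult mult.assoc)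
    moreover have "Arg (B x) - \<phi> = (Arg (A x) + \<phi>) - pi" by (simp add: \<phi>_def field_simps)
    moreover have "cis (\<psi> - pi) = - cis \<psi>" for \<psi> by (simp add: complex_eq_iff)
    ultimately show ?thesis by (simp add: algebra_simps)
  qed
  ultimately show ?thesis by (simp add: norm_mult flip: of_real_add)
qed

section \<open>Monomial coefficients of bounded pluriharmonic functions\<close>

text \<open>
Take \<open>M k = X ^ e k\<close> with distinct exponents \<open>e k\<close>. Then \<open>\<beta>\<close> and \<open>\<alpha>\<close> have equal weighted sums exactly
when \<open>X\<close> is a root of the nonzero polynomial with coefficient \<open>\<beta> k - \<alpha> k\<close> at \<open>e k\<close>. Finitely many \<open>\<beta>\<close>
rule out only finitely many \<open>X\<close>.
\<close>
lemma separating_weights: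
  fixes K :: "('n::finite \<Rightarrow> nat) set"
  assumes "finite K"
  obtains M :: "'n \<Rightarrow> nat" where "\<And>k. M k > 0"
    and "\<And>\<beta>. \<beta> \<in> K \<Longrightarrow> \<beta> \<noteq> \<alpha> \<Longrightarrow> (\<Sum>k\<in>UNIV. M k * \<beta> k) \<noteq> (\<Sum>k\<in>UNIV. M k * \<alpha> k)"
proof -
  obtain e :: "'n \<Rightarrow> nat" where e: "inj e"
    using finite_imp_inj_to_nat_seg[of "UNIV :: 'n set"] by auto
  define q :: "('n \<Rightarrow> nat) \<Rightarrow> real poly" where
    "q \<beta> = (\<Sum>k\<in>UNIV. monom (real (\<beta> k) - real (\<alpha> k)) (e k))" for \<beta>
  have poly_q: "poly (q \<beta>) x = (\<Sum>k\<in>UNIV. (real (\<beta> k) - real (\<alpha> k)) * x ^ e k)" for \<beta> x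
    by (simp add: q_def poly_sum poly_monom)
  have "q \<beta> \<noteq> 0" if "\<beta> \<noteq> \<alpha>" for \<beta>
  proof -
    from that obtain j where "\<beta> j \<noteq> \<alpha> j" by blast
    moreover have "coeff (q \<beta>) (e j) = real (\<beta> j) - real (\<alpha> j)"
      using e by (simp add: q_def coeff_sum inj_eq)
    ultimately show ?thesis by auto
  qed
  then have "finite (\<Union>\<beta>\<in>K - {\<alpha>}. {x. poly (q \<beta>) x = 0})"
    using assms by (intro finite_UN_I poly_roots_finite) auto
  moreover have "infinite (real ` {1..})"
    by (simp add: finite_image_iff infinite_Ici)
  ultimately have "\<not> real ` {1..} \<subseteq> (\<Union>\<beta>\<in>K - {\<alpha>}. {x. poly (q \<beta>) x = 0})"
    using finite_subset by blast
  then obtain X :: nat where X: "X \<ge> 1" "\<And>\<beta>. \<beta> \<in> K \<Longrightarrow> \<beta> \<noteq> \<alpha> \<Longrightarrow> poly (q \<beta>) (real X) \<noteq> 0"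
    by auto
  show ?thesis
  proof
    show "X ^ e k > 0" for k using X by simp
    show "(\<Sum>k\<in>UNIV. X ^ e k * \<beta> k) \<noteq> (\<Sum>k\<in>UNIV. X ^ e k * \<alpha> k)" if "\<beta> \<in> K" "\<beta> \<noteq> \<alpha>" for \<beta>
    proof
      assume "(\<Sum>k\<in>UNIV. X ^ e k * \<beta> k) = (\<Sum>k\<in>UNIV. X ^ e k * \<alpha> k)"
      then have "real (\<Sum>k\<in>UNIV. X ^ e k * \<beta> k) = real (\<Sum>k\<in>UNIV. X ^ e k * \<alpha> k)" by simp
      then have "poly (q \<beta>) (real X) = 0"
        by (simp add: poly_q algebra_simps sum_subtractf)
      with X that show False by blast
    qed
  qed
qed

definition torus_curve :: "('n::finite \<Rightarrow> real) \<Rightarrow> ('n \<Rightarrow> nat) \<Rightarrow> real \<Rightarrow> complex ^ 'n" where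
  "torus_curve r M s = (\<chi> k. of_real (r k) * cis (real (M k) * s))"

lemma mi_monom_torus_curve:
  "mi_monom (torus_curve r M s) \<beta> = of_real (\<Prod>k\<in>UNIV. r k ^ \<beta> k) * cis (real (\<Sum>k\<in>UNIV. M k * \<beta> k) * s)"
proof -
  have "(\<Prod>k\<in>S. cis (real (M k) * s) ^ \<beta> k) = cis (real (\<Sum>k\<in>S. M k * \<beta> k) * s)" for S
    by (induction S rule: infinite_finite_induct) (auto simp: Complex.DeMoivre cis_mult algebra_simps)
  then show ?thesis
    by (simp add: mi_monom_def torus_curve_def power_mult_distrib prod.distrib)
qed

text \<open>
The finite set \<open>K\<close> is chosen from the absolute convergence on the torus alone, before the weights \<open>M\<close>:
along each curve the terms have the same moduli \<open>|a_\<beta>| r^\<beta>\<close> and \<open>|b_\<beta>| r^\<beta>\<close>, so the tail outside \<open>K\<close>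
stays below \<open>\<epsilon>\<close> whatever \<open>M\<close> is. This order lets \<open>M\<close> separate \<open>\<alpha>\<close> from the rest of \<open>K\<close>.
\<close>
lemma torus_coeff_bound:
  fixes f :: "complex ^ 'n::finite \<Rightarrow> complex" and r :: "'n \<Rightarrow> real"
  assumes torus: "\<And>z. (\<And>k. cmod (z $ k) = r k) \<Longrightarrow> z \<in> S"
    and r: "\<And>k. r k \<ge> 0"
    and f: "f ` S \<subseteq> ball 0 1" and exp: "has_pluriharmonic_expansion_on f a b S"
    and \<alpha>: "mi_abs \<alpha> \<ge> 1"
  shows "(cmod (a \<alpha>) + cmod (b \<alpha>)) * (\<Prod>k\<in>UNIV. r k ^ \<alpha> k) \<le> 4 / pi"
proof -
  define R where "R \<beta> = (\<Prod>k\<in>UNIV. r k ^ \<beta> k)" for \<beta>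
  have R: "R \<beta> \<ge> 0" for \<beta> unfolding R_def by (intro prod_nonneg) (use r in auto)
  from exp obtain h g where
    a: "\<And>z. z \<in> S \<Longrightarrow> ((\<lambda>\<beta>. a \<beta> * mi_monom z \<beta>) has_sum h z) UNIV" and
    b: "\<And>z. z \<in> S \<Longrightarrow> ((\<lambda>\<beta>. b \<beta> * mi_monom z \<beta>) has_sum g z) UNIV" and
    fhg: "\<And>z. z \<in> S \<Longrightarrow> f z = h z + cnj (g z)"
    unfolding has_pluriharmonic_expansion_on_def by blast
  have curve: "torus_curve r M s \<in> S" for M s
    by (rule torus) (use r in \<open>simp add: torus_curve_def norm_mult\<close>)
  \<comment> \<open>zero weights and \<open>s = 0\<close> give the constant curve at the point \<open>r\<close>, where the monomials equal \<open>R\<close>\<close>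
  have "(\<lambda>\<beta>. cmod (c \<beta>) * R \<beta>) summable_on UNIV"
    if "((\<lambda>\<beta>. c \<beta> * mi_monom (torus_curve r (\<lambda>_. 0) 0) \<beta>) has_sum y) UNIV" for c y
  proof -
    have "(\<lambda>\<beta>. c \<beta> * mi_monom (torus_curve r (\<lambda>_. 0) 0) \<beta>) summable_on UNIV"
      using that by (auto simp: summable_on_def)
    then have "(\<lambda>\<beta>. norm (c \<beta> * mi_monom (torus_curve r (\<lambda>_. 0) 0) \<beta>)) summable_on UNIV"
      by (simp add: summable_on_iff_abs_summable_on_complex)
    then show ?thesis using R
      by (simp add: mi_monom_torus_curve norm_mult flip: R_def)
  qed
  from this[OF a] this[OF b] curve
  have "(\<lambda>\<beta>. cmod (a \<beta>) * R \<beta> + cmod (b \<beta>) * R \<beta>) summable_on UNIV"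
    by (intro summable_on_add) blast+
  then obtain T where T: "((\<lambda>\<beta>. cmod (a \<beta>) * R \<beta> + cmod (b \<beta>) * R \<beta>) has_sum T) UNIV"
    by (auto simp: summable_on_def)
  have approx: "(cmod (a \<alpha>) + cmod (b \<alpha>)) * R \<alpha> \<le> 4 / pi * (1 + \<epsilon>)" if "\<epsilon> > 0" for \<epsilon>
  proof -
    have "\<forall>\<^sub>F K in finite_subsets_at_top UNIV. dist (\<Sum>\<beta>\<in>K. cmod (a \<beta>) * R \<beta> + cmod (b \<beta>) * R \<beta>) T < \<epsilon>"
      using T that unfolding has_sum_def by (rule tendstoD)
    then obtain K0 where K0: "finite K0" and close: "\<And>K. finite K \<Longrightarrow> K0 \<subseteq> K \<Longrightarrow>
        dist (\<Sum>\<beta>\<in>K. cmod (a \<beta>) * R \<beta> + cmod (b \<beta>) * R \<beta>) T < \<epsilon>"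
      unfolding eventually_finite_subsets_at_top by auto
    define K where "K = insert \<alpha> K0"
    have K: "finite K" "\<alpha> \<in> K" and KT: "dist (\<Sum>\<beta>\<in>K. cmod (a \<beta>) * R \<beta> + cmod (b \<beta>) * R \<beta>) T < \<epsilon>"
      using K0 by (auto simp: K_def intro!: close)
    obtain M :: "'n \<Rightarrow> nat" where M: "\<And>k. M k > 0"
      and sep: "\<And>\<beta>. \<beta> \<in> K \<Longrightarrow> \<beta> \<noteq> \<alpha> \<Longrightarrow> (\<Sum>k\<in>UNIV. M k * \<beta> k) \<noteq> (\<Sum>k\<in>UNIV. M k * \<alpha> k)"
      using separating_weights[OF K(1)] by metis
    define N where "N \<beta> = (\<Sum>k\<in>UNIV. M k * \<beta> k)" for \<beta>
    have "cmod (a \<alpha> * R \<alpha>) + cmod (cnj (b \<alpha>) * R \<alpha>) \<le> 4 / pi * (1 + \<epsilon>)"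
    proof (rule trig_sum_coeff_bound[where A = "\<lambda>\<beta>. a \<beta> * R \<beta>" and B = "\<lambda>\<beta>. cnj (b \<beta>) * R \<beta>" and N = N and x = \<alpha>, OF K])
      \<comment> \<open>positive weights keep the frequency of \<open>\<alpha>\<close> away from 0, hence distinct from all negative ones\<close>
      have "mi_abs \<alpha> \<le> N \<alpha>"
        unfolding N_def mi_abs_def
        by (intro sum_mono) (use M in \<open>simp add: Suc_leI\<close>)
      then show "0 < N \<alpha>" using \<alpha> by simp
      show "N \<beta> \<noteq> N \<alpha>" if "\<beta> \<in> K" "\<beta> \<noteq> \<alpha>" for \<beta>
        using sep that by (simp add: N_def)
      fix s
      let ?z = "torus_curve r M s"
      let ?t = "\<lambda>\<beta>. a \<beta> * R \<beta> * cis (real (N \<beta>) * s) + cnj (b \<beta>) * R \<beta> * cis (- (real (N \<beta>) * s))"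
      have mon: "mi_monom ?z \<beta> = R \<beta> * cis (real (N \<beta>) * s)" for \<beta>
        by (simp add: mi_monom_torus_curve R_def N_def)
      have "((\<lambda>\<beta>. a \<beta> * mi_monom ?z \<beta> + cnj (b \<beta> * mi_monom ?z \<beta>)) has_sum f ?z) UNIV"
        unfolding fhg[OF curve] by (intro has_sum_add a curve has_sum_cnj_iff[THEN iffD2] b)
      then have t: "(?t has_sum f ?z) UNIV"
        by (simp add: mon cis_cnj mult.assoc)
      have "norm (f ?z - sum ?t K) \<le> T - (\<Sum>\<beta>\<in>K. cmod (a \<beta>) * R \<beta> + cmod (b \<beta>) * R \<beta>)"
      proof (rule norm_infsum_le)
        show "(?t has_sum f ?z - sum ?t K) (UNIV - K)"
          by (rule has_sum_Diff[OF t]) (use K in auto)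
        show "((\<lambda>\<beta>. cmod (a \<beta>) * R \<beta> + cmod (b \<beta>) * R \<beta>) has_sum
            T - (\<Sum>\<beta>\<in>K. cmod (a \<beta>) * R \<beta> + cmod (b \<beta>) * R \<beta>)) (UNIV - K)"
          by (rule has_sum_Diff[OF T]) (use K in auto)
        show "norm (?t \<beta>) \<le> cmod (a \<beta>) * R \<beta> + cmod (b \<beta>) * R \<beta>" for \<beta>
          by (rule norm_triangle_le) (use R in \<open>simp add: norm_mult\<close>)
      qed
      also have "\<dots> < \<epsilon>" using KT by (simp add: dist_real_def)
      finally have "norm (f ?z - sum ?t K) < \<epsilon>" .
      moreover have "norm (f ?z) < 1" using f curve by (auto simp: image_subset_iff)
      ultimately show "cmod (sum ?t K) \<le> 1 + \<epsilon>"
        using norm_triangle_ineq4[of "f ?z" "f ?z - sum ?t K"] by simp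
    qed
    then show ?thesis using R[of \<alpha>] by (simp add: norm_mult algebra_simps)
  qed
  show ?thesis
    unfolding R_def[symmetric]
  proof (rule field_le_epsilon)
    fix e :: real assume "e > 0"
    with approx[of "e * pi / 4"] show "(cmod (a \<alpha>) + cmod (b \<alpha>)) * R \<alpha> \<le> 4 / pi + e"
      by (simp add: algebra_simps)
  qed
qed

section \<open>The unit balls\<close>

lemma lp_ball_infinity_iff: "z \<in> lp_ball \<infinity> \<longleftrightarrow> (\<forall>k. cmod (z $ k) < 1)"
  by (simp add: lp_ball_def lp_norm_def)

lemma lp_ball_ereal_iff:
  assumes "1 \<le> q"
  shows "z \<in> lp_ball (ereal q) \<longleftrightarrow> (\<Sum>k\<in>UNIV. cmod (z $ k) powr q) < 1"
proof -
  let ?S = "\<Sum>k\<in>UNIV. cmod (z $ k) powr q"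
  have "?S \<ge> 0" by (intro sum_nonneg) simp
  then have "?S powr (1 / q) < 1 \<longleftrightarrow> ?S < 1"
    using powr_less_mono2[of "1 / q" ?S 1] ge_one_powr_ge_zero[of ?S "1 / q"] assms by fastforce
  then show ?thesis by (simp add: lp_ball_def lp_norm_def)
qed

lemma ereal_ge_1_cases:
  fixes p :: ereal
  assumes "1 \<le> p"
  obtains (real) q where "p = ereal q" "1 \<le> q" | (inf) "p = \<infinity>"
  using assms by (cases p) auto

text \<open>
The balls are complete Reinhardt domains: membership depends monotonically on the moduli of the
coordinates. This yields star-shapedness without the Minkowski inequality.
\<close>
lemma lp_ball_mono:
  assumes "1 \<le> p" "z \<in> lp_ball p" "\<And>k. cmod (w $ k) \<le> cmod (z $ k)"
  shows "w \<in> lp_ball p"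
  using assms(1)
proof (cases rule: ereal_ge_1_cases)
  case (real q)
  have "(\<Sum>k\<in>UNIV. cmod (w $ k) powr q) \<le> (\<Sum>k\<in>UNIV. cmod (z $ k) powr q)"
    using assms(3) real by (intro sum_mono powr_mono2) auto
  with assms(2) show ?thesis unfolding real(1) lp_ball_ereal_iff[OF real(2)] by linarith
next
  case inf
  with assms(2,3) show ?thesis by (metis lp_ball_infinity_iff le_less_trans)
qed

lemma lp_ball_component:
  assumes "1 \<le> p" "z \<in> lp_ball p"
  shows "cmod (z $ k) < 1"
  using assms(1)
proof (cases rule: ereal_ge_1_cases)
  case (real q)
  have "cmod (z $ k) powr q \<le> (\<Sum>k\<in>UNIV. cmod (z $ k) powr q)"
    by (rule member_le_sum) auto
  then have "cmod (z $ k) powr q < 1"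
    using assms(2) unfolding real(1) lp_ball_ereal_iff[OF real(2)] by linarith
  then show ?thesis
    using ge_one_powr_ge_zero[of "cmod (z $ k)" q] real by fastforce
qed (use assms in \<open>simp add: lp_ball_infinity_iff\<close>)

lemma open_lp_ball:
  assumes "1 \<le> p"
  shows "open (lp_ball p :: (complex ^ 'n::finite) set)"
  using assms
proof (cases rule: ereal_ge_1_cases)
  case (real q)
  have "open {z :: complex ^ 'n. (\<Sum>k\<in>UNIV. cmod (z $ k) powr q) < 1}"
    using real by (intro open_Collect_less continuous_intros continuous_on_powr') auto
  also have "{z :: complex ^ 'n. (\<Sum>k\<in>UNIV. cmod (z $ k) powr q) < 1} = lp_ball p"
    using lp_ball_ereal_iff[OF real(2)] real(1) by auto
  finally show ?thesis .
next
  case inf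
  have "open {z :: complex ^ 'n. \<forall>k. cmod (z $ k) < 1}"
    unfolding Collect_all_eq by (intro open_INT ballI open_Collect_less continuous_intros) auto
  also have "{z :: complex ^ 'n. \<forall>k. cmod (z $ k) < 1} = lp_ball p"
    using lp_ball_infinity_iff inf by auto
  finally show ?thesis .
qed

lemma zero_in_lp_ball:
  assumes "1 \<le> p"
  shows "0 \<in> lp_ball p"
  using assms by (cases rule: ereal_ge_1_cases) (auto simp: lp_ball_infinity_iff lp_ball_ereal_iff)

lemma connected_lp_ball:
  assumes "1 \<le> p"
  shows "connected (lp_ball p :: (complex ^ 'n::finite) set)"
proof (intro starlike_imp_connected)
  have "closed_segment 0 z \<subseteq> lp_ball p" if z: "z \<in> lp_ball p" for z :: "complex ^ 'n"
  proof
    fix w assume "w \<in> closed_segment 0 z"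
    then obtain u where u: "0 \<le> u" "u \<le> 1" "w = u *\<^sub>R z"
      by (auto simp: in_segment)
    have "cmod (w $ k) \<le> cmod (z $ k)" for k
      using u by (simp add: mult_left_le_one_le)
    then show "w \<in> lp_ball p" by (rule lp_ball_mono[OF assms z])
  qed
  then show "starlike (lp_ball p :: (complex ^ 'n) set)"
    unfolding starlike_def using zero_in_lp_ball[OF assms] by blast
qed

section \<open>Optimal radii\<close>

text \<open>
For \<open>p = \<infinity>\<close> the exponent is 0 and each radius is \<open>s\<close>, except that \<open>\<alpha> k = 0\<close> gives
\<open>0 powr 0 = 0\<close>; this is harmless since such a coordinate does not occur in the monomial.
\<close>
lemma extremal_radii_in_lp_ball:
  fixes \<alpha> :: "'n::finite \<Rightarrow> nat"
  assumes p: "1 \<le> p" and \<alpha>: "mi_abs \<alpha> \<ge> 1" and s: "0 < s" "s < 1"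
    and z: "\<And>k. cmod (z $ k) = s * (real (\<alpha> k) / real (mi_abs \<alpha>)) powr real_of_ereal (1 / p)"
  shows "z \<in> lp_ball p"
  using p
proof (cases rule: ereal_ge_1_cases)
  case (real q)
  have "real_of_ereal (1 / p) = 1 / q"
    using real by (simp add: one_ereal_def)
  then have "cmod (z $ k) powr q = s powr q * (real (\<alpha> k) / real (mi_abs \<alpha>))" for k
    using real s by (simp add: z powr_mult powr_powr del: real_of_ereal.simps)
  then have "(\<Sum>k\<in>UNIV. cmod (z $ k) powr q) = s powr q * ((\<Sum>k\<in>UNIV. real (\<alpha> k)) / real (mi_abs \<alpha>))"
    by (simp flip: sum_distrib_left sum_divide_distrib)
  also have "(\<Sum>k\<in>UNIV. real (\<alpha> k)) = real (mi_abs \<alpha>)"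
    by (simp add: mi_abs_def)
  also have "s powr q * (real (mi_abs \<alpha>) / real (mi_abs \<alpha>)) = s powr q" using \<alpha> by simp
  also have "\<dots> < 1" using s real powr_less_mono2[of q s 1] by simp
  finally show ?thesis using real by (simp add: lp_ball_ereal_iff)
next
  case inf
  have "cmod (z $ k) \<le> s" for k
    using s by (simp add: z inf powr_def)
  then show ?thesis using inf s(2) by (metis lp_ball_infinity_iff le_less_trans)
qed

lemma monom_at_extremal_radii:
  fixes \<alpha> :: "'n::finite \<Rightarrow> nat"
  shows "(\<Prod>k\<in>UNIV. (s * (real (\<alpha> k) / real (mi_abs \<alpha>)) powr t) ^ \<alpha> k) =
    s ^ mi_abs \<alpha> * (real (mi_self_power \<alpha>) / real (mi_abs \<alpha> ^ mi_abs \<alpha>)) powr t"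
proof -
  have "(x powr t) ^ n = (x ^ n) powr t" for x :: real and n
    by (induction n) (simp_all add: powr_mult)
  then have "((real (\<alpha> k) / real (mi_abs \<alpha>)) powr t) ^ \<alpha> k = (real (\<alpha> k) ^ \<alpha> k / real (mi_abs \<alpha>) ^ \<alpha> k) powr t" for k
    by (simp add: power_divide)
  then have "(\<Prod>k\<in>UNIV. (s * (real (\<alpha> k) / real (mi_abs \<alpha>)) powr t) ^ \<alpha> k) =
      (\<Prod>k\<in>UNIV. s ^ \<alpha> k) * (\<Prod>k\<in>UNIV. (real (\<alpha> k) ^ \<alpha> k / real (mi_abs \<alpha>) ^ \<alpha> k) powr t)"
    by (simp add: power_mult_distrib prod.distrib)
  also have "\<dots> = s ^ mi_abs \<alpha> * (\<Prod>k\<in>UNIV. real (\<alpha> k) ^ \<alpha> k / real (mi_abs \<alpha>) ^ \<alpha> k) powr t"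
    by (simp add: prod_powr_distrib mi_abs_def power_sum)
  also have "(\<Prod>k\<in>UNIV. real (\<alpha> k) ^ \<alpha> k / real (mi_abs \<alpha>) ^ \<alpha> k) = real (mi_self_power \<alpha>) / real (mi_abs \<alpha> ^ mi_abs \<alpha>)"
    by (simp add: prod_dividef mi_self_power_def mi_abs_def power_sum)
  finally show ?thesis .
qed

text \<open>
The extremal radii are those for \<open>s = 1\<close>, outside the open ball; the bound there is the left limit of
the bounds for \<open>s < 1\<close>.
\<close>
lemma lp_ball_coeff_bound:
  fixes f :: "complex ^ 'n::finite \<Rightarrow> complex"
  assumes p: "1 \<le> p" and f: "f ` lp_ball p \<subseteq> ball 0 1"
    and exp: "has_pluriharmonic_expansion_on f a b (lp_ball p)" and \<alpha>: "mi_abs \<alpha> \<ge> 1"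
  shows "cmod (a \<alpha>) + cmod (b \<alpha>)
    \<le> 4 / pi * (real (mi_abs \<alpha> ^ mi_abs \<alpha>) / real (mi_self_power \<alpha>)) powr real_of_ereal (1 / p)"
proof -
  let ?t = "real_of_ereal (1 / p)" and ?c = "cmod (a \<alpha>) + cmod (b \<alpha>)"
  let ?Q = "real (mi_self_power \<alpha>) / real (mi_abs \<alpha> ^ mi_abs \<alpha>)"
  have bound: "?c * (s ^ mi_abs \<alpha> * ?Q powr ?t) \<le> 4 / pi" if s: "0 < s" "s < 1" for s
    using torus_coeff_bound[where r = "\<lambda>k. s * (real (\<alpha> k) / real (mi_abs \<alpha>)) powr ?t", OF _ _ f exp \<alpha>]
      extremal_radii_in_lp_ball[OF p \<alpha> s] s
    by (simp only: monom_at_extremal_radii) simp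
  have "((\<lambda>s. ?c * (s ^ mi_abs \<alpha> * ?Q powr ?t)) \<longlongrightarrow> ?c * (1 ^ mi_abs \<alpha> * ?Q powr ?t)) (at_left 1)"
    by (intro tendsto_intros)
  moreover have "\<forall>\<^sub>F s in at_left 1. ?c * (s ^ mi_abs \<alpha> * ?Q powr ?t) \<le> 4 / pi"
    using eventually_at_left_real[of 0 1] by (rule eventually_mono) (use bound in auto)
  ultimately have "?c * (1 ^ mi_abs \<alpha> * ?Q powr ?t) \<le> 4 / pi"
    by (intro tendsto_upperbound) auto
  moreover have "?Q > 0"
    using \<alpha> by (auto simp: mi_self_power_def intro!: prod_pos divide_pos_pos)
  then have "?Q powr ?t > 0" by (simp only: powr_gt_zero)
  ultimately have "?c \<le> 4 / pi / ?Q powr ?t"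
    by (simp only: pos_le_divide_eq power_one mult_1_left)
  then show ?thesis
    by (simp add: powr_divide)
qed

section \<open>Pluriharmonic functions of one coordinate\<close>

text \<open>
Chain rule for the real part of a holomorphic function of a real-affine map, in the form needed both
for the coordinate map on the whole space and for complex lines. The formula for the second derivative
makes the Laplacian readable: for complex linear \<open>L\<close>, the values at \<open>(1, 1)\<close> and \<open>(i, i)\<close> cancel
because \<open>i * i = -1\<close>.
\<close>
lemma has_C2_derivs_Re_holomorphic:
  fixes L :: "'a::real_normed_vector \<Rightarrow> complex"
  assumes L: "bounded_linear L"
    and \<phi>: "\<And>x. x \<in> S \<Longrightarrow> (\<phi> has_field_derivative \<phi>' (c + L x)) (at (c + L x))"
    and \<phi>': "\<And>x. x \<in> S \<Longrightarrow> (\<phi>' has_field_derivative \<phi>'' (c + L x)) (at (c + L x))"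
    and cont: "continuous_on ((\<lambda>x. c + L x) ` S) \<phi>''"
  obtains f' f'' where "has_C2_derivs_on (\<lambda>x. complex_of_real (Re (\<phi> (c + L x)))) f' f'' S"
    and "\<And>x u v. blinfun_apply (blinfun_apply (f'' x) u) v = complex_of_real (Re (\<phi>'' (c + L x) * L u * L v))"
proof -
  define T :: "complex \<Rightarrow>\<^sub>L complex" where "T = Blinfun (\<lambda>w. complex_of_real (Re w))"
  have T: "blinfun_apply T w = complex_of_real (Re w)" for w
    unfolding T_def by (subst bounded_linear_Blinfun_apply) (auto intro: bounded_linear_compose[OF bounded_linear_of_real bounded_linear_Re])
  define M where "M w = blinfun_mult_right w o\<^sub>L Blinfun L" for w
  have M: "blinfun_apply (M w) u = w * L u" for w u
    by (simp add: M_def bounded_linear_Blinfun_apply[OF L])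
  have blM: "bounded_linear M"
    unfolding M_def by (intro bounded_linear_intros)
  \<comment> \<open>\<open>B\<close> and \<open>D\<close> are fixed bounded linear maps that turn \<open>\<phi>'\<close> and \<open>\<phi>''\<close> into the first and second derivative\<close>
  define B where "B w = T o\<^sub>L M w" for w
  have blB: "bounded_linear B"
    unfolding B_def
    by (rule bounded_linear_compose[OF bounded_bilinear.bounded_linear_right[OF bounded_bilinear_blinfun_compose] blM])
  define D where "D w = Blinfun B o\<^sub>L M w" for w
  have blD: "bounded_linear D"
    unfolding D_def
    by (rule bounded_linear_compose[OF bounded_bilinear.bounded_linear_right[OF bounded_bilinear_blinfun_compose] blM])
  have A: "((\<lambda>x. c + L x) has_derivative L) (at x)" for x
    using bounded_linear.has_derivative[OF L has_derivative_ident] by (auto intro!: derivative_eq_intros)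
  show ?thesis
  proof
    show "has_C2_derivs_on (\<lambda>x. complex_of_real (Re (\<phi> (c + L x)))) (\<lambda>x. B (\<phi>' (c + L x))) (\<lambda>x. D (\<phi>'' (c + L x))) S"
      unfolding has_C2_derivs_on_def
    proof (intro conjI ballI)
      fix x assume x: "x \<in> S"
      have "((\<lambda>x. \<phi> (c + L x)) has_derivative (\<lambda>u. \<phi>' (c + L x) * L u)) (at x)"
        using has_derivative_compose[OF A, of \<phi>] \<phi>[OF x] unfolding has_field_derivative_def by blast
      from bounded_linear.has_derivative[OF blinfun.bounded_linear_right[of T] this]
      show "((\<lambda>x. complex_of_real (Re (\<phi> (c + L x)))) has_derivative blinfun_apply (B (\<phi>' (c + L x)))) (at x)"
        unfolding T by (rule has_derivative_eq_rhs) (simp add: B_def T M fun_eq_iff)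
      have "((\<lambda>x. \<phi>' (c + L x)) has_derivative (\<lambda>u. \<phi>'' (c + L x) * L u)) (at x)"
        using has_derivative_compose[OF A, of \<phi>'] \<phi>'[OF x] unfolding has_field_derivative_def by blast
      from bounded_linear.has_derivative[OF blB this]
      show "((\<lambda>x. B (\<phi>' (c + L x))) has_derivative blinfun_apply (D (\<phi>'' (c + L x)))) (at x)"
        by (rule has_derivative_eq_rhs) (simp add: D_def bounded_linear_Blinfun_apply[OF blB] M fun_eq_iff)
    next
      have "continuous_on S (\<lambda>x. \<phi>'' (c + L x))"
        by (rule continuous_on_compose2[OF cont])
           (auto intro: continuous_on_add continuous_on_const linear_continuous_on[OF L])
      then show "continuous_on S (\<lambda>x. D (\<phi>'' (c + L x)))"
        by (rule bounded_linear.continuous_on[OF blD])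
    qed
    show "blinfun_apply (blinfun_apply (D (\<phi>'' (c + L x))) u) v = complex_of_real (Re (\<phi>'' (c + L x) * L u * L v))" for x u v
      by (simp add: D_def B_def T M bounded_linear_Blinfun_apply[OF blB])
  qed
qed

text \<open>
A segment that left \<open>\<Omega>\<close> would meet the frontier at a point closer to \<open>z\<close> than the boundary distance.
\<close>
lemma add_scaled_direction_mem:
  fixes z \<theta> :: "complex ^ 'n::finite"
  assumes "z \<in> \<Omega>" "norm \<theta> = 1" "ereal (cmod \<zeta>) < boundary_dist \<Omega> z"
  shows "z + \<zeta> *s \<theta> \<in> \<Omega>"
proof (rule ccontr)
  assume "z + \<zeta> *s \<theta> \<notin> \<Omega>"
  then have "closed_segment z (z + \<zeta> *s \<theta>) \<inter> frontier \<Omega> \<noteq> {}"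
    using assms(1) by (intro connected_Int_frontier) auto
  then obtain w where w: "w \<in> closed_segment z (z + \<zeta> *s \<theta>)" "w \<in> frontier \<Omega>" by blast
  have "norm (\<zeta> *s \<theta>) = cmod \<zeta> * norm \<theta>"
    by (simp add: norm_vec_def norm_mult L2_set_right_distrib)
  then have "dist z w \<le> cmod \<zeta>"
    using dist_in_closed_segment[OF w(1)] assms(2) by (simp add: dist_norm norm_minus_commute)
  moreover have "boundary_dist \<Omega> z \<le> ereal (dist z w)"
    unfolding boundary_dist_def using w(2) by (rule INF_lower)
  ultimately show False
    using assms(3) by (metis ereal_less_eq(3) leD less_le_trans)
qed

lemma pluriharmonic_on_Re_component:
  fixes \<Omega> :: "(complex ^ 'n::finite) set"
  assumes "open \<Omega>" "connected \<Omega>"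
    and \<phi>: "\<And>z. z \<in> \<Omega> \<Longrightarrow> (\<phi> has_field_derivative \<phi>' (z $ k)) (at (z $ k))"
    and \<phi>': "\<And>z. z \<in> \<Omega> \<Longrightarrow> (\<phi>' has_field_derivative \<phi>'' (z $ k)) (at (z $ k))"
    and cont: "continuous_on ((\<lambda>z. z $ k) ` \<Omega>) \<phi>''"
  shows "pluriharmonic_on (\<lambda>z. complex_of_real (Re (\<phi> (z $ k)))) \<Omega>"
  unfolding pluriharmonic_on_def
proof (intro conjI ballI allI impI)
  have "bounded_linear (\<lambda>z :: complex ^ 'n. z $ k)"
    by (rule bounded_linear_vec_nth)
  then obtain f' f'' where "has_C2_derivs_on (\<lambda>z. complex_of_real (Re (\<phi> (0 + z $ k)))) f' f'' \<Omega>"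
    using has_C2_derivs_Re_holomorphic[of "\<lambda>z. z $ k" \<Omega> \<phi> \<phi>' 0 \<phi>''] \<phi> \<phi>' cont
    unfolding add_0 by metis
  then show "C2_on (\<lambda>z. complex_of_real (Re (\<phi> (z $ k)))) \<Omega>"
    unfolding C2_on_def add_0 by blast
next
  fix z \<theta> :: "complex ^ 'n" assume z: "z \<in> \<Omega>" and \<theta>: "norm \<theta> = 1"
  let ?S = "{\<zeta>. ereal (cmod \<zeta>) < boundary_dist \<Omega> z}"
  have mem: "z + \<zeta> *s \<theta> \<in> \<Omega>" if "\<zeta> \<in> ?S" for \<zeta>
    using add_scaled_direction_mem z \<theta> that by blast
  have eq: "z $ k + \<zeta> * \<theta> $ k = (z + \<zeta> *s \<theta>) $ k" for \<zeta> by simp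
  have "(\<lambda>\<zeta>. z $ k + \<zeta> * \<theta> $ k) ` ?S \<subseteq> (\<lambda>z. z $ k) ` \<Omega>"
    unfolding eq using mem by blast
  with cont have "continuous_on ((\<lambda>\<zeta>. z $ k + \<zeta> * \<theta> $ k) ` ?S) \<phi>''"
    by (rule continuous_on_subset)
  then obtain f' f'' where
    "has_C2_derivs_on (\<lambda>\<zeta>. complex_of_real (Re (\<phi> (z $ k + \<zeta> * \<theta> $ k)))) f' f'' ?S"
    and f'': "\<And>\<zeta> u v. blinfun_apply (blinfun_apply (f'' \<zeta>) u) v =
       complex_of_real (Re (\<phi>'' (z $ k + \<zeta> * \<theta> $ k) * (u * \<theta> $ k) * (v * \<theta> $ k)))"
    using has_C2_derivs_Re_holomorphic[OF bounded_linear_mult_left[of "\<theta> $ k"], of ?S \<phi> \<phi>' "z $ k" \<phi>'']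
      \<phi>[OF mem] \<phi>'[OF mem] unfolding eq by blast
  moreover have "Re (c * (1 * t) * (1 * t)) + Re (c * (\<i> * t) * (\<i> * t)) = 0" for c t :: complex
    by (simp add: algebra_simps)
  ultimately show "harmonic_on (\<lambda>\<zeta>. complex_of_real (Re (\<phi> ((z + \<zeta> *s \<theta>) $ k)))) ?S"
    unfolding harmonic_on_def eq[symmetric]
    by (intro exI[of _ f'] exI[of _ f'']) (simp only: f'' flip: of_real_add, simp)
qed (fact assms)+

section \<open>The extremal function\<close>

definition Arctan_coeff :: "nat \<Rightarrow> complex" where
  "Arctan_coeff n = (if odd n then - \<i> * \<i> ^ n / of_nat n else 0)"

text \<open>
The power series also converges at a real point between \<open>|w|\<close> and 1, which makes it absolutely
convergent at \<open>w\<close>, hence unconditionally summable.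
\<close>
lemma has_sum_Arctan:
  assumes "cmod w < 1"
  shows "((\<lambda>n. Arctan_coeff n * w ^ n) has_sum Arctan w) UNIV"
proof (rule norm_summable_imp_has_sum)
  obtain x :: real where x: "cmod w < x" "x < 1" using dense assms by blast
  then have "0 \<le> x" using norm_ge_zero[of w] by linarith
  have "summable (\<lambda>n. Arctan_coeff n * of_real x ^ n)"
    using Arctan_series(1)[of "of_real x"] x \<open>0 \<le> x\<close> by (auto simp: Arctan_coeff_def sums_iff)
  then show "summable (\<lambda>n. norm (Arctan_coeff n * w ^ n))"
    by (rule powser_insidea) (use x \<open>0 \<le> x\<close> in simp)
  show "(\<lambda>n. Arctan_coeff n * w ^ n) sums Arctan w"
    using Arctan_series(1)[OF assms] by (simp add: Arctan_coeff_def)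
qed

text \<open>
A power series in one coordinate, read as a series over all multi-indices: it is supported on the
multiples of the \<open>k\<close>-th unit multi-index.
\<close>
lemma has_sum_one_variable_series:
  fixes z :: "complex ^ 'n::finite"
  assumes "((\<lambda>n. c n * (z $ k) ^ n) has_sum y) UNIV"
  shows "((\<lambda>\<alpha>. (if \<forall>j. j \<noteq> k \<longrightarrow> \<alpha> j = 0 then c (\<alpha> k) else 0) * mi_monom z \<alpha>) has_sum y) UNIV"
proof -
  define single :: "nat \<Rightarrow> 'n \<Rightarrow> nat" where "single n = (\<lambda>j. if j = k then n else 0)" for n
  have inj: "inj single" by (auto simp: inj_on_def single_def fun_eq_iff)
  have mon: "mi_monom z (single n) = (z $ k) ^ n" for n
    by (simp add: mi_monom_def single_def if_distrib[of "power _"] prod.delta cong: if_cong)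
  let ?t = "\<lambda>\<alpha>. (if \<forall>j. j \<noteq> k \<longrightarrow> \<alpha> j = 0 then c (\<alpha> k) else 0) * mi_monom z \<alpha>"
  have "?t \<circ> single = (\<lambda>n. c n * (z $ k) ^ n)"
    by (auto simp: mon fun_eq_iff) (simp_all add: single_def)
  then have "(?t has_sum y) (range single)"
    using assms by (simp add: has_sum_reindex[OF inj])
  moreover have "\<alpha> \<in> range single" if "\<forall>j. j \<noteq> k \<longrightarrow> \<alpha> j = 0" for \<alpha>
    using that by (intro image_eqI[of _ _ "\<alpha> k"]) (auto simp: single_def fun_eq_iff)
  ultimately show ?thesis
    by (subst has_sum_cong_neutral[where T = "range single" and g = ?t]) auto
qed

text \<open>
\<open>Arctan z = (i/2) Ln ((1 - i z) / (1 + i z))\<close>, and the Cayley quotient maps the unit disc into the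
right half-plane, where the logarithm has imaginary part in \<open>(-\<pi>/2, \<pi>/2)\<close>.
\<close>
lemma abs_Re_Arctan_less:
  assumes "cmod z < 1"
  shows "\<bar>Re (Arctan z)\<bar> < pi / 4"
proof -
  have "Re ((1 - \<i> * z) * cnj (1 + \<i> * z)) = 1 - (cmod z)\<^sup>2"
    unfolding cmod_power2 by (simp add: power2_eq_square algebra_simps)
  then have "Re ((1 - \<i> * z) / (1 + \<i> * z)) > 0"
    unfolding Re_complex_div_gt_0 using assms by (simp add: power_less_one_iff)
  from Re_Ln_pos_lt_imp[OF this] show ?thesis
    by (simp add: Arctan_def)
qed

text \<open>
With \<open>h = g = (2/\<pi>) Arctan z_k\<close>, the function \<open>h + cnj g\<close> is \<open>(4/\<pi>) Re (Arctan z_k)\<close>; the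
same coefficients therefore serve for both series.
\<close>
lemma Arctan_extremal:
  fixes k :: "'n::finite"
  assumes p: "1 \<le> p"
  defines "f \<equiv> \<lambda>z :: complex ^ 'n. complex_of_real (Re (of_real (4 / pi) * Arctan (z $ k)))"
    and "a \<equiv> \<lambda>\<alpha>. if \<forall>j. j \<noteq> k \<longrightarrow> \<alpha> j = 0 then of_real (2 / pi) * Arctan_coeff (\<alpha> k) else 0"
  shows "pluriharmonic_on f (lp_ball p)"
    and "f ` lp_ball p \<subseteq> ball 0 1"
    and "has_pluriharmonic_expansion_on f a a (lp_ball p)"
proof -
  note less = lp_ball_component[OF p, of _ k]
  have Im: "\<bar>Im w\<bar> < 1" if "cmod w < 1" for w
    using abs_Im_le_cmod[of w] that by linarith
  have nz: "1 + w\<^sup>2 \<noteq> 0" if "cmod w < 1" for w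
  proof
    assume "1 + w\<^sup>2 = 0"
    then have "(cmod w)\<^sup>2 = 1" by (metis add_eq_0_iff norm_minus_cancel norm_one norm_power)
    with that show False using power_less_one_iff[of "cmod w" 2] by simp
  qed
  show "pluriharmonic_on f (lp_ball p)"
    unfolding f_def
  proof (rule pluriharmonic_on_Re_component[OF open_lp_ball[OF p] connected_lp_ball[OF p]])
    fix z :: "complex ^ 'n" assume z: "z \<in> lp_ball p"
    show "((\<lambda>w. of_real (4 / pi) * Arctan w) has_field_derivative (\<lambda>w. of_real (4 / pi) * inverse (1 + w\<^sup>2)) (z $ k)) (at (z $ k))"
      by (intro DERIV_cmult has_field_derivative_Arctan Im less z)
    show "((\<lambda>w. of_real (4 / pi) * inverse (1 + w\<^sup>2)) has_field_derivative
        (\<lambda>w. of_real (4 / pi) * (- (inverse (1 + w\<^sup>2) * (2 * w) * inverse (1 + w\<^sup>2)))) (z $ k)) (at (z $ k))"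
      by (intro DERIV_cmult) (use nz[OF less[OF z]] in \<open>auto intro!: derivative_eq_intros\<close>)
  next
    show "continuous_on ((\<lambda>z. z $ k) ` lp_ball p)
        (\<lambda>w. of_real (4 / pi) * (- (inverse (1 + w\<^sup>2) * (2 * w) * inverse (1 + w\<^sup>2))))"
      by (intro continuous_intros) (use nz less in auto)
  qed
  show "f ` lp_ball p \<subseteq> ball 0 1"
  proof safe
    fix z :: "complex ^ 'n" assume "z \<in> lp_ball p"
    then have "\<bar>4 / pi * Re (Arctan (z $ k))\<bar> < 1"
      using abs_Re_Arctan_less[OF less] by (simp add: abs_mult field_simps)
    moreover have "f z = of_real (4 / pi * Re (Arctan (z $ k)))"
      by (simp add: f_def complex_eq_iff)
    ultimately show "f z \<in> ball 0 1"
      by (simp only: mem_ball_0 norm_of_real)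
  qed
  show "has_pluriharmonic_expansion_on f a a (lp_ball p)"
    unfolding has_pluriharmonic_expansion_on_def
  proof (intro exI[of _ "\<lambda>z. of_real (2 / pi) * Arctan (z $ k)"] ballI conjI)
    fix z :: "complex ^ 'n" assume z: "z \<in> lp_ball p"
    have "((\<lambda>n. of_real (2 / pi) * Arctan_coeff n * (z $ k) ^ n) has_sum of_real (2 / pi) * Arctan (z $ k)) UNIV"
      using has_sum_cmult_right[OF has_sum_Arctan[OF less[OF z]], of "of_real (2 / pi)"] by (simp add: mult.assoc)
    from has_sum_one_variable_series[OF this]
    show h: "((\<lambda>\<alpha>. a \<alpha> * mi_monom z \<alpha>) has_sum of_real (2 / pi) * Arctan (z $ k)) UNIV"
      unfolding a_def .
    show "((\<lambda>\<alpha>. a \<alpha> * mi_monom z \<alpha>) has_sum of_real (2 / pi) * Arctan (z $ k)) UNIV"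
      by (rule h)
    show "f z = of_real (2 / pi) * Arctan (z $ k) + cnj (of_real (2 / pi) * Arctan (z $ k))"
      unfolding f_def complex_add_cnj by (simp add: complex_eq_iff)
  qed
qed

section \<open>Sharp coefficient estimate\<close>

theorem theorem2p6:
  fixes p :: ereal
  assumes "1 \<le> p"
  shows
    "(\<forall>(f :: complex ^ 'n::finite \<Rightarrow> complex) a b.
        pluriharmonic_on f (lp_ball p) \<longrightarrow>
        f ` lp_ball p \<subseteq> ball 0 1 \<longrightarrow>
        has_pluriharmonic_expansion_on f a b (lp_ball p) \<longrightarrow>
        (\<forall>\<alpha>. mi_abs \<alpha> \<ge> 1 \<longrightarrow>
           cmod (a \<alpha>) + cmod (b \<alpha>)
             \<le> 4 / pi * (real (mi_abs \<alpha> ^ mi_abs \<alpha>) / real (mi_self_power \<alpha>)) powr real_of_ereal (1 / p)))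
     \<and>
     (\<forall>C::real. C < 4 / pi \<longrightarrow>
        (\<exists>(f :: complex ^ 'n \<Rightarrow> complex) a b \<alpha>.
           pluriharmonic_on f (lp_ball p) \<and>
           f ` lp_ball p \<subseteq> ball 0 1 \<and>
           has_pluriharmonic_expansion_on f a b (lp_ball p) \<and>
           mi_abs \<alpha> \<ge> 1 \<and>
           cmod (a \<alpha>) + cmod (b \<alpha>)
             > C * (real (mi_abs \<alpha> ^ mi_abs \<alpha>) / real (mi_self_power \<alpha>)) powr real_of_ereal (1 / p)))"
proof (intro conjI allI impI)
  fix f :: "complex ^ 'n \<Rightarrow> complex" and a b and \<alpha> :: "'n \<Rightarrow> nat"
  assume "f ` lp_ball p \<subseteq> ball 0 1" "has_pluriharmonic_expansion_on f a b (lp_ball p)" "mi_abs \<alpha> \<ge> 1"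
  then show "cmod (a \<alpha>) + cmod (b \<alpha>)
      \<le> 4 / pi * (real (mi_abs \<alpha> ^ mi_abs \<alpha>) / real (mi_self_power \<alpha>)) powr real_of_ereal (1 / p)"
    by (rule lp_ball_coeff_bound[OF assms, of f a b \<alpha>])
next
  fix C :: real assume C: "C < 4 / pi"
  fix k :: 'n
  let ?f = "\<lambda>z :: complex ^ 'n. complex_of_real (Re (of_real (4 / pi) * Arctan (z $ k)))"
  let ?e = "\<lambda>j. if j = k then 1 else 0 :: nat"
  let ?a = "\<lambda>\<alpha> :: 'n \<Rightarrow> nat. if \<forall>j. j \<noteq> k \<longrightarrow> \<alpha> j = 0 then of_real (2 / pi) * Arctan_coeff (\<alpha> k) else 0"
  have e: "mi_abs ?e = 1" by (simp add: mi_abs_def)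
  have e': "mi_self_power ?e = 1" unfolding mi_self_power_def by (rule prod.neutral) simp
  have "cmod (?a ?e) + cmod (?a ?e) = 4 / pi"
    by (simp add: Arctan_coeff_def norm_mult norm_divide)
  with C have "cmod (?a ?e) + cmod (?a ?e) >
      C * (real (mi_abs ?e ^ mi_abs ?e) / real (mi_self_power ?e)) powr real_of_ereal (1 / p)"
    unfolding e e' by simp
  moreover have "mi_abs ?e \<ge> 1" using e by simp
  moreover note Arctan_extremal[OF assms, of k]
  ultimately show "\<exists>(f :: complex ^ 'n \<Rightarrow> complex) a b \<alpha>.
           pluriharmonic_on f (lp_ball p) \<and>
           f ` lp_ball p \<subseteq> ball 0 1 \<and>
           has_pluriharmonic_expansion_on f a b (lp_ball p) \<and>
           mi_abs \<alpha> \<ge> 1 \<and>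
           cmod (a \<alpha>) + cmod (b \<alpha>)
             > C * (real (mi_abs \<alpha> ^ mi_abs \<alpha>) / real (mi_self_power \<alpha>)) powr real_of_ereal (1 / p)"
    by (intro exI[of _ ?f] exI[of _ ?a] exI[of _ ?e] conjI)
qed

end
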